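(* Let $l\ge2$ be an integer and let $(\alpha,\beta,\gamma)=(0,0,0)$ or $(\alpha,\beta,\gamma)=(1,w^2,w)$. Let $$H=\left(\begin{array}{c|c}\tilde H&\mathbf 0_{6\times 6(l-2)}\\ \hline \mathbf 0_{3(l-2)\times 11}& I_{l-2}\otimes\begin{pmatrix}1&0&0&1&1&1\\0&1&0&1&w&w^2\\0&0&1&1&w^2&w\end{pmatrix}\end{array}\right),$$ $$\tilde H=\begin{pmatrix}1&0&0&1&1&\alpha&0&0&0&0&0\\0&1&0&1&w&\beta&0&0&0&0&0\\0&0&1&1&w^2&\gamma&0&0&0&0&0\\0&0&0&0&0&1&0&0&1&1&1\\0&0&0&0&0&0&1&0&1&w&w^2\\0&0&0&0&0&0&0&1&1&w^2&w\end{pmatrix}$$ over $\mathbb F_4$. Then the linear code with parity-check matrix $H$ is an optimal quaternary $[n,k,d]$ $(r,\delta)$-LRC code with $n=6l-1$, $k=3l-1$, $d=4$, $r=3$, $\delta=4$.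
   Context: $\mathbb F_4=\{0,1,w,w^2\}$ with $w^2=w+1$, $w^3=1$; $I_m$ is the $m\times m$ identity matrix and $\otimes$ the Kronecker product (for $l=2$ the blocks involving $l-2$ are empty). For a linear code $\mathcal C\subseteq\mathbb{F}_q^n$ and $R\subseteq[n]=\{1,\dots,n\}$, $\mathcal C|_R$ is the code obtained by puncturing (deleting) the coordinates outside $R$. An $[n,k,d]$ linear code $\mathcal C$ is an $(r,\delta)$-LRC code if for every $i\in[n]$ there is $R_i\subseteq[n]$ with $i\in R_i$, $|R_i|\le r+\delta-1$, such that $\mathcal C|_{R_i}$ has minimum distance at least $\delta$ (every nonzero word has weight at least $\delta$). Every such code satisfies $d\le n-k+1-(\lceil k/r\rceil-1)(\delta-1)$; it is $d$-optimal if equality holds. An $(r,\delta)$-LRC code is $r$-optimal if it is not an $(r',\delta)$-LRC code for any $1\le r'<r$. "Optimal $(r,\delta)$-LRC code" means an $(r,\delta)$-LRC code that is both $d$-optimal and $r$-optimal, with $d\ge\delta>2$ and $k>r\ge1$. *)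

theory Defs
  imports "HOL-Library.Extended_Nat" "HOL-Library.Cardinality" "Jordan_Normal_Form.Matrix_Kernel"
begin

text \<open>
  A code of length n is a set of vectors in \<open>carrier_vec n\<close>; coordinates are numbered
  from 0, so the coordinate set is \<open>{..<n}\<close> instead of \<open>{1..n}\<close>.
\<close>

definition linear_code :: "nat \<Rightarrow> 'a::field vec set \<Rightarrow> bool" where
  "linear_code n C \<longleftrightarrow> subspace class_ring C (module_vec TYPE('a) n)"

definition code_dim :: "nat \<Rightarrow> 'a::field vec set \<Rightarrow> nat" where
  "code_dim n C = vectorspace.dim class_ring ((module_vec TYPE('a) n)\<lparr>carrier := C\<rparr>)"

definition hamming_weight :: "'a::zero vec \<Rightarrow> nat" where
  "hamming_weight v = card {i. i < dim_vec v \<and> v $ i \<noteq> 0}"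

text \<open>
  The values are extended naturals, so the code without nonzero words has minimum distance
  \<open>\<infinity>\<close> and \<open>enat \<delta> \<le> min_distance C\<close> says exactly that every nonzero word of
  the linear code C has weight at least \<open>\<delta>\<close>.
\<close>

definition min_distance :: "'a::zero vec set \<Rightarrow> enat" where
  "min_distance C = (INF v \<in> {v \<in> C. v \<noteq> 0\<^sub>v (dim_vec v)}. enat (hamming_weight v))"

definition code_params :: "nat \<Rightarrow> nat \<Rightarrow> nat \<Rightarrow> 'a::field vec set \<Rightarrow> bool" where
  "code_params n k d C \<longleftrightarrow>
     linear_code n C \<and> code_dim n C = k \<and> min_distance C = enat d"

definition puncture_vec :: "nat set \<Rightarrow> 'a vec \<Rightarrow> 'a vec" where
  "puncture_vec R v = vec_of_list (nths (list_of_vec v) R)"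

definition puncture :: "nat set \<Rightarrow> 'a vec set \<Rightarrow> 'a vec set" where
  "puncture R C = puncture_vec R ` C"

definition lrc :: "nat \<Rightarrow> nat \<Rightarrow> nat \<Rightarrow> nat \<Rightarrow> nat \<Rightarrow> 'a::field vec set \<Rightarrow> bool" where
  "lrc n k d r \<delta> C \<longleftrightarrow> code_params n k d C \<and>
     (\<forall>i<n. \<exists>R\<subseteq>{..<n}. i \<in> R \<and> card R \<le> r + \<delta> - 1 \<and>
        enat \<delta> \<le> min_distance (puncture R C))"

text \<open>The Singleton-type bound is evaluated over the integers, without truncated subtraction.\<close>

definition d_optimal_lrc :: "nat \<Rightarrow> nat \<Rightarrow> nat \<Rightarrow> nat \<Rightarrow> nat \<Rightarrow> 'a::field vec set \<Rightarrow> bool" where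
  "d_optimal_lrc n k d r \<delta> C \<longleftrightarrow> lrc n k d r \<delta> C \<and>
     int d = int n - int k + 1 - (\<lceil>real k / real r\<rceil> - 1) * (int \<delta> - 1)"

definition r_optimal_lrc :: "nat \<Rightarrow> nat \<Rightarrow> nat \<Rightarrow> nat \<Rightarrow> nat \<Rightarrow> 'a::field vec set \<Rightarrow> bool" where
  "r_optimal_lrc n k d r \<delta> C \<longleftrightarrow> lrc n k d r \<delta> C \<and>
     (\<forall>r'. 1 \<le> r' \<and> r' < r \<longrightarrow> \<not> lrc n k d r' \<delta> C)"

definition optimal_lrc :: "nat \<Rightarrow> nat \<Rightarrow> nat \<Rightarrow> nat \<Rightarrow> nat \<Rightarrow> 'a::field vec set \<Rightarrow> bool" where
  "optimal_lrc n k d r \<delta> C \<longleftrightarrow>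
     d_optimal_lrc n k d r \<delta> C \<and> r_optimal_lrc n k d r \<delta> C \<and>
     d \<ge> \<delta> \<and> \<delta> > 2 \<and> k > r \<and> r \<ge> 1"

definition kronecker_mat :: "'a::times mat \<Rightarrow> 'a mat \<Rightarrow> 'a mat" where
  "kronecker_mat A B = mat (dim_row A * dim_row B) (dim_col A * dim_col B)
     (\<lambda>(i, j). A $$ (i div dim_row B, j div dim_col B) * B $$ (i mod dim_row B, j mod dim_col B))"

definition H_tilde :: "'a::field \<Rightarrow> 'a \<Rightarrow> 'a \<Rightarrow> 'a \<Rightarrow> 'a mat" where
  "H_tilde w \<alpha> \<beta> \<gamma> = mat_of_rows_list 11
    [[1, 0, 0, 1, 1,   \<alpha>, 0, 0, 0, 0,   0],
     [0, 1, 0, 1, w,   \<beta>, 0, 0, 0, 0,   0],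
     [0, 0, 1, 1, w^2, \<gamma>, 0, 0, 0, 0,   0],
     [0, 0, 0, 0, 0,   1, 0, 0, 1, 1,   1],
     [0, 0, 0, 0, 0,   0, 1, 0, 1, w,   w^2],
     [0, 0, 0, 0, 0,   0, 0, 1, 1, w^2, w]]"

definition H_block :: "'a::field \<Rightarrow> 'a mat" where
  "H_block w = mat_of_rows_list 6
    [[1, 0, 0, 1, 1,   1],
     [0, 1, 0, 1, w,   w^2],
     [0, 0, 1, 1, w^2, w]]"

definition H_mat :: "nat \<Rightarrow> 'a::field \<Rightarrow> 'a \<Rightarrow> 'a \<Rightarrow> 'a \<Rightarrow> 'a mat" where
  "H_mat l w \<alpha> \<beta> \<gamma> = four_block_mat
     (H_tilde w \<alpha> \<beta> \<gamma>)          (0\<^sub>m 6 (6 * (l - 2)))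
     (0\<^sub>m (3 * (l - 2)) 11)   (kronecker_mat (1\<^sub>m (l - 2)) (H_block w))"

end

theory Submission
  imports Defs
begin

text \<open>
  Since \<open>(\<alpha>, \<beta>, \<gamma>) = \<alpha> \<cdot> (1, w\<^sup>2, w)\<close> with \<open>\<alpha> \<in> {0, 1}\<close>, every three consecutive rows of
  the parity-check matrix test six consecutive coordinates against the hexacode, a \<open>[6, 3, 4]\<close>
  code; neighbouring windows are disjoint, except that the first two share coordinate 5, which is
  scaled by \<open>\<alpha>\<close> in the first one. The windows are therefore repair sets with \<open>\<delta> = 4\<close>, and
  \<open>d \<ge> 4\<close> follows because every coordinate lies in one of them. The parity-check matrix is onto,
  which gives k. If a repair set R of coordinate 10 had at most 5 elements, then either R misses one
  of the coordinates 6, 7, 8, 9 and some word of weight 4 supported in \<open>{6..10}\<close> has between 1 and 3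
  nonzero entries on R, or \<open>R = {6..10}\<close> and a word with support \<open>{5, 6, 7, 8}\<close> outside
  \<open>{0..4}\<close> does.
\<close>

section \<open>Kernels of matrices as linear codes\<close>

lemma linear_map_mult_mat_vec:
  fixes A :: "'a::field mat"
  assumes "A \<in> carrier_mat nr nc"
  shows "linear_map class_ring (module_vec TYPE('a) nc) (module_vec TYPE('a) nr) ((*\<^sub>v) A)"
proof -
  interpret V: vectorspace class_ring "module_vec TYPE('a) nc" by (rule vec_vs)
  interpret W: vectorspace class_ring "module_vec TYPE('a) nr" by (rule vec_vs)
  show ?thesis
    using assms by unfold_locales
      (auto simp: module_hom_def module_vec_simps class_ring_simps mult_add_distrib_mat_vec mult_mat_vec)
qed

lemma ker_mult_mat_vec:
  fixes A :: "'a::field mat"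
  assumes "A \<in> carrier_mat nr nc"
  shows "mod_hom.ker (module_vec TYPE('a) nc) (module_vec TYPE('a) nr) ((*\<^sub>v) A) = mat_kernel A"
proof -
  interpret T: linear_map class_ring "module_vec TYPE('a) nc" "module_vec TYPE('a) nr" "(*\<^sub>v) A"
    using assms by (rule linear_map_mult_mat_vec)
  show ?thesis using mat_kernel[OF assms] by (auto simp: T.ker_def module_vec_simps)
qed

lemma linear_code_mat_kernel:
  fixes A :: "'a::field mat"
  assumes "A \<in> carrier_mat nr nc"
  shows "linear_code nc (mat_kernel A)"
proof -
  interpret T: linear_map class_ring "module_vec TYPE('a) nc" "module_vec TYPE('a) nr" "(*\<^sub>v) A"
    using assms by (rule linear_map_mult_mat_vec)
  show ?thesis using T.kerT_is_subspace ker_mult_mat_vec[OF assms] by (simp add: linear_code_def)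
qed

text \<open>Rank-nullity: surjectivity makes the rank \<open>nr\<close>, so the kernel has the
  remaining dimension.\<close>

lemma code_dim_mat_kernel:
  fixes A :: "'a::field mat"
  assumes A: "A \<in> carrier_mat nr nc"
    and surj: "\<And>y. y \<in> carrier_vec nr \<Longrightarrow> \<exists>x \<in> carrier_vec nc. A *\<^sub>v x = y"
  shows "code_dim nc (mat_kernel A) = nc - nr"
proof -
  interpret T: linear_map class_ring "module_vec TYPE('a) nc" "module_vec TYPE('a) nr" "(*\<^sub>v) A"
    using A by (rule linear_map_mult_mat_vec)
  interpret N: vec_space "TYPE('a)" nc .
  interpret R: vec_space "TYPE('a)" nr .
  have "T.im = carrier_vec nr"
    using A surj by (force simp: T.im_def module_vec_simps image_def)
  then have "code_dim nc (mat_kernel A) + nr = nc"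
    using T.rank_nullity[OF N.fin_dim] ker_mult_mat_vec[OF A] R.dim_is_n N.dim_is_n
    by (simp add: code_dim_def module_vec_def)
  then show ?thesis by simp
qed

section \<open>Weights, minimum distance and puncturing\<close>

lemma hamming_weight_eq_0_iff: "hamming_weight v = 0 \<longleftrightarrow> v = 0\<^sub>v (dim_vec v)"
  by (auto simp: hamming_weight_def vec_eq_iff)

text \<open>Being nonzero is phrased through the weight, so that for punctured codes both
  occurrences turn into the same cardinality.\<close>

lemma enat_le_min_distance_iff:
  "enat \<delta> \<le> min_distance C \<longleftrightarrow> (\<forall>v\<in>C. hamming_weight v \<noteq> 0 \<longrightarrow> \<delta> \<le> hamming_weight v)"
  by (auto simp: min_distance_def le_INF_iff hamming_weight_eq_0_iff)

text \<open>The list \<open>J\<close> of retained coordinates is distinct, so counting positions in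
  the punctured word amounts to counting coordinates of \<open>v\<close> in
  \<open>R\<close>.\<close>

lemma hamming_weight_puncture_vec:
  "hamming_weight (puncture_vec R v) = card {i\<in>R. i < dim_vec v \<and> v $ i \<noteq> 0}"
proof -
  define J where "J = nths [0..<dim_vec v] R"
  have J: "distinct J" "set J = {i\<in>R. i < dim_vec v}"
    by (auto simp: J_def set_nths) (metis add_0 nth_upt)
  have "puncture_vec R v = vec_of_list (map (($) v) J)"
    by (simp add: puncture_vec_def J_def list_of_vec_map nths_map del: vec_of_list_map)
  then have "hamming_weight (puncture_vec R v) = card {k. k < length J \<and> v $ (J ! k) \<noteq> 0}"
    unfolding hamming_weight_def 
    by (auto intro!: arg_cong[where f = card] simp: vec_of_list_index simp del: vec_of_list_map)
  also have "\<dots> = length (filter (\<lambda>i. v $ i \<noteq> 0) J)"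
    by (simp add: length_filter_conv_card)
  also have "\<dots> = card {i\<in>R. i < dim_vec v \<and> v $ i \<noteq> 0}"
    using J distinct_card[of "filter (\<lambda>i. v $ i \<noteq> 0) J"] by (simp add: conj_assoc)
  finally show ?thesis .
qed

section \<open>Arithmetic in characteristic 2\<close>

text \<open>Translation by 1 permutes the field, so summing all elements before and after it gives 4
  = 0, that is (1 + 1)^2 = 0, and a field has no zero divisors.\<close>

lemma char2_of_card4:
  assumes "CARD('a::field) = 4"
  shows "(1::'a) + 1 = 0"
proof -
  have "finite (UNIV :: 'a set)" using assms by (intro card_ge_0_finite) simp
  have "(\<Sum>x\<in>UNIV. x::'a) = (\<Sum>x\<in>UNIV. x + 1)"
    by (rule sum.reindex_bij_witness[of _ "\<lambda>x. x + 1" "\<lambda>x. x - 1"]) auto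
  then have "of_nat CARD('a) = (0::'a)" by (simp add: sum.distrib)
  then have "(1 + 1) * (1 + 1) = (0::'a)" unfolding assms by simp
  then show ?thesis by (metis mult_eq_0_iff)
qed

lemma char2_field_simps:
  fixes x y :: "'a::field"
  assumes "(1::'a) + 1 = 0"
  shows "x + x = 0" "x + (x + y) = y" "- x = x" "x + y = 0 \<longleftrightarrow> x = y"
proof -
  show *: "x + x = 0" for x :: 'a using assms by (metis distrib_left mult.right_neutral mult_zero_right)
  show "x + (x + y) = y" using * by (simp add: add.assoc[symmetric])
  show neg: "- x = x" for x :: 'a using * by (metis minus_unique)
  show "x + y = 0 \<longleftrightarrow> x = y" using neg by (metis add_eq_0_iff)
qed

section \<open>The hexacode and its minimum weight\<close>

definition hex_syndrome :: "'a::field \<Rightarrow> (nat \<Rightarrow> 'a) \<Rightarrow> nat \<Rightarrow> 'a" where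
  "hex_syndrome w f c = (\<Sum>k<6. H_block w $$ (c, k) * f k)"

lemma hex_syndrome_simps:
  "hex_syndrome w f 0 = f 0 + f 3 + f 4 + f 5"
  "hex_syndrome w f (Suc 0) = f 1 + f 3 + w * f 4 + w\<^sup>2 * f 5"
  "hex_syndrome w f 2 = f 2 + f 3 + w\<^sup>2 * f 4 + w * f 5"
  by (simp_all add: hex_syndrome_def H_block_def mat_of_rows_list_def eval_nat_numeral)

definition hexacode :: "'a::field \<Rightarrow> (nat \<Rightarrow> 'a) \<Rightarrow> bool" where
  "hexacode w f \<longleftrightarrow> (\<forall>c<3. hex_syndrome w f c = 0)"

lemma hexacode_iff:
  "hexacode w f \<longleftrightarrow> f 0 + f 3 + f 4 + f 5 = 0 \<and>
     f 1 + f 3 + w * f 4 + w\<^sup>2 * f 5 = 0 \<and> f 2 + f 3 + w\<^sup>2 * f 4 + w * f 5 = 0"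
proof -
  have "(\<forall>c<3. P c) \<longleftrightarrow> P 0 \<and> P (Suc 0) \<and> P 2" for P :: "nat \<Rightarrow> bool"
    by (auto simp: less_Suc_eq numeral_eq_Suc)
  then show ?thesis by (simp only: hexacode_def hex_syndrome_simps)
qed

text \<open>The parity checks express the first three entries through the last three, which range
  over the four field elements; the nonzero triples are checked exhaustively.\<close>

lemma hexacode_weight:
  fixes w :: "'a::field"
  assumes card: "CARD('a) = 4" and w: "w\<^sup>2 = w + 1" and hex: "hexacode w f"
    and nz: "k < 6" "f k \<noteq> 0"
  shows "card {i. i < 6 \<and> f i \<noteq> 0} \<ge> 4"
proof -
  have two: "(1::'a) + 1 = 0" using card by (rule char2_of_card4)
  note dbl = char2_field_simps[OF two]
  have w0: "w \<noteq> 0" using w by auto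
  have w1: "w \<noteq> 1" using w two by auto
  have w2: "w + 1 \<noteq> 0" "1 + w \<noteq> 0" using w1 by (auto simp: dbl)
  have ww: "w * w = w + 1" using w by (simp add: power2_eq_square)
  have "card {0, 1, w, w + 1} = 4" using w0 w1 w2 by (auto simp: dbl)
  then have UNIV: "{0, 1, w, w + 1} = (UNIV :: 'a set)"
    using card by (intro card_subset_eq) (auto intro: card_ge_0_finite)
  have el: "x \<in> {0, 1, w, w + 1}" for x using UNIV by auto
  have f: "f 0 = f 3 + f 4 + f 5" "f 1 = f 3 + w * f 4 + (w + 1) * f 5"
    "f 2 = f 3 + (w + 1) * f 4 + w * f 5"
    using hex unfolding hexacode_iff w by (simp_all only: add.assoc dbl)
  have "card {i. i < 6 \<and> f i \<noteq> 0} = (\<Sum>i<6. of_bool (f i \<noteq> 0))"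
    by (simp add: sum.If_cases of_bool_def Int_def)
  also have "\<dots> = of_bool (f 0 \<noteq> 0) + of_bool (f 1 \<noteq> 0) + of_bool (f 2 \<noteq> 0)
     + of_bool (f 3 \<noteq> 0) + of_bool (f 4 \<noteq> 0) + of_bool (f 5 \<noteq> 0)"
    by (simp add: eval_nat_numeral)
  also have "\<dots> \<ge> (4::nat)"
  proof -
    have "k \<in> {0, 1, 2, 3, 4, 5}" using nz(1) by auto
    \<comment> \<open>If the last three entries vanished, so would the first three, contradicting
      \<open>f k \<noteq> 0\<close>.\<close>
    then have nz': "\<not> (f 3 = 0 \<and> f 4 = 0 \<and> f 5 = 0)" using nz(2) f by auto
    show ?thesis
      using el[of "f 3"] el[of "f 4"] el[of "f 5"] nz' unfolding f
      by (elim insertE emptyE; simp add: algebra_simps dbl ww w0 w1 w2)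
  qed
  finally show ?thesis .
qed

section \<open>The parity-check matrix as a family of windows\<close>

text \<open>The matrix is block diagonal: with the columns grouped into \<open>m\<close> blocks of
  length \<open>c\<close>, the identity factor kills every block except number
  \<open>i div r\<close>.\<close>

lemma kronecker_one_mult_vec:
  fixes B :: "'a::field mat"
  assumes B: "B \<in> carrier_mat r c" and x: "x \<in> carrier_vec (m * c)" and i: "i < m * r"
  shows "(kronecker_mat (1\<^sub>m m) B *\<^sub>v x) $ i = (\<Sum>k<c. B $$ (i mod r, k) * x $ ((i div r) * c + k))"
proof -
  have b: "i div r < m" using i by (simp add: less_mult_imp_div_less)
  let ?g = "\<lambda>j. (if i div r = j div c then 1 else 0) * B $$ (i mod r, j mod c) * x $ j"
  have "(kronecker_mat (1\<^sub>m m) B *\<^sub>v x) $ i = (\<Sum>j<m * c. ?g j)"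
    using B x i b
    by (auto simp: kronecker_mat_def scalar_prod_def less_mult_imp_div_less lessThan_atLeast0 intro!: sum.cong)
  also have "\<dots> = (\<Sum>a<m. \<Sum>j\<in>{a * c..<a * c + c}. ?g j)"
    by (rule sum.nat_group[symmetric])
  also have "\<dots> = (\<Sum>a<m. \<Sum>k<c. ?g (a * c + k))"
    by (rule sum.cong[OF refl], subst sum.atLeastLessThan_shift_0) (simp add: lessThan_atLeast0 comp_def)
  also have "\<dots> = (\<Sum>a<m. if i div r = a then \<Sum>k<c. B $$ (i mod r, k) * x $ (a * c + k) else 0)"
    by (intro sum.cong refl) auto
  also have "\<dots> = (\<Sum>k<c. B $$ (i mod r, k) * x $ ((i div r) * c + k))"
    using b by simp
  finally show ?thesis .
qed

text \<open>
  Window b covers the coordinates \<open>6 * b - 1, \<dots>, 6 * b + 4\<close>. Window 0 covers only \<open>0, \<dots>, 4\<close>: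
  the truncated subtraction makes it start at 0, and its sixth entry borrows coordinate 5 from window 1.
\<close>

definition window :: "'a::field \<Rightarrow> 'a vec \<Rightarrow> nat \<Rightarrow> nat \<Rightarrow> 'a" where
  "window \<alpha> v b k = (if b = 0 \<and> k = 5 then \<alpha> * v $ 5 else v $ (6 * b - 1 + k))"

text \<open>Choosing \<beta> and \<gamma> as these multiples of \<alpha> makes the column of
  coordinate 5 in the first three rows equal to \<alpha> times the last column of
  \<open>H_block w\<close>. Those rows thus see \<open>\<alpha> * v $ 5\<close> as a sixth
  entry.\<close>

lemma H_tilde_mult_vec:
  fixes w :: "'a::field"
  assumes "v \<in> carrier_vec 11" "i < 6"
  shows "(H_tilde w \<alpha> (\<alpha> * w\<^sup>2) (\<alpha> * w) *\<^sub>v v) $ i = hex_syndrome w (window \<alpha> v (i div 3)) (i mod 3)"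
proof -
  have "i \<in> {0, 1, 2, 3, 4, 5}" using assms(2) by auto
  moreover have "(\<Sum>k = 0..<11. g k) = g 0 + g 1 + g 2 + g 3 + g 4 + g 5 + g 6 + g 7 + g 8 + g 9 + g 10"
    for g :: "nat \<Rightarrow> 'a"
    by (simp add: eval_nat_numeral)
  ultimately show ?thesis
    using assms(1)
    by (elim insertE emptyE; simp add: H_tilde_def mat_of_rows_list_def scalar_prod_def
      hex_syndrome_simps window_def numeral_2_eq_2[symmetric] ac_simps)
qed

lemma H_tilde_carrier: "H_tilde w \<alpha> \<beta> \<gamma> \<in> carrier_mat 6 11"
  by (intro carrier_matI) (simp_all add: H_tilde_def mat_of_rows_list_def)

lemma H_block_carrier: "H_block w \<in> carrier_mat 3 6"
  by (intro carrier_matI) (simp_all add: H_block_def mat_of_rows_list_def)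

lemma kronecker_one_carrier:
  "B \<in> carrier_mat r c \<Longrightarrow> kronecker_mat (1\<^sub>m m) B \<in> carrier_mat (m * r) (m * c)"
  by (simp add: kronecker_mat_def)

lemma H_mat_carrier:
  assumes "l \<ge> 2"
  shows "H_mat l w \<alpha> \<beta> \<gamma> \<in> carrier_mat (3 * l) (6 * l - 1)"
proof -
  have "H_mat l w \<alpha> \<beta> \<gamma> \<in> carrier_mat (6 + (l - 2) * 3) (11 + (l - 2) * 6)"
    unfolding H_mat_def
    by (intro four_block_carrier_mat H_tilde_carrier kronecker_one_carrier H_block_carrier)
  moreover have "6 + (l - 2) * 3 = 3 * l" "11 + (l - 2) * 6 = 6 * l - 1" using assms by linarith+
  ultimately show ?thesis by simp
qed

lemma H_mat_mult_vec:
  fixes w :: "'a::field"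
  assumes l: "l \<ge> 2" and v: "v \<in> carrier_vec (6 * l - 1)" and i: "i < 3 * l"
  shows "(H_mat l w \<alpha> (\<alpha> * w\<^sup>2) (\<alpha> * w) *\<^sub>v v) $ i
    = hex_syndrome w (window \<alpha> v (i div 3)) (i mod 3)"
proof -
  define m where "m = l - 2"
  have lm: "l = m + 2" using l by (simp add: m_def)
  define x where "x = vec_first v 11"
  define y where "y = vec_last v (6 * m)"
  have vxy: "v = x @\<^sub>v y" using v unfolding x_def y_def lm by (intro vec_first_last_append[symmetric]) auto
  have x: "x \<in> carrier_vec 11" and y: "y \<in> carrier_vec (6 * m)" by (auto simp: x_def y_def)
  let ?T = "H_tilde w \<alpha> (\<alpha> * w\<^sup>2) (\<alpha> * w)" and ?K = "kronecker_mat (1\<^sub>m m) (H_block w)"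
  have T: "?T \<in> carrier_mat 6 11" by (rule H_tilde_carrier)
  have B: "H_block w \<in> carrier_mat 3 6" by (rule H_block_carrier)
  then have K: "?K \<in> carrier_mat (3 * m) (6 * m)"
    using kronecker_one_carrier[of _ 3 6 m] by (simp only: mult.commute)
  have "H_mat l w \<alpha> (\<alpha> * w\<^sup>2) (\<alpha> * w) *\<^sub>v v
      = (?T *\<^sub>v x + 0\<^sub>m 6 (6 * m) *\<^sub>v y) @\<^sub>v (0\<^sub>m (3 * m) 11 *\<^sub>v x + ?K *\<^sub>v y)"
    unfolding vxy H_mat_def m_def[symmetric]
    by (rule four_block_mat_mult_vec[OF T _ _ K x y]) auto
  also have "\<dots> = (?T *\<^sub>v x) @\<^sub>v (?K *\<^sub>v y)"
  proof (rule arg_cong2[where f = "(@\<^sub>v)"])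
    show "?T *\<^sub>v x + 0\<^sub>m 6 (6 * m) *\<^sub>v y = ?T *\<^sub>v x" using T y by (intro eq_vecI) auto
    show "0\<^sub>m (3 * m) 11 *\<^sub>v x + ?K *\<^sub>v y = ?K *\<^sub>v y" using K x by (intro eq_vecI) auto
  qed
  finally have H: "H_mat l w \<alpha> (\<alpha> * w\<^sup>2) (\<alpha> * w) *\<^sub>v v = (?T *\<^sub>v x) @\<^sub>v (?K *\<^sub>v y)" .
  show ?thesis
  proof (cases "i < 6")
    case True
    then have "i div 3 < 2" by auto
    then have "window \<alpha> x (i div 3) k = window \<alpha> v (i div 3) k" if "k < 6" for k
      using that x y unfolding vxy window_def by (cases "i div 3") auto
    then have "hex_syndrome w (window \<alpha> x (i div 3)) (i mod 3)
        = hex_syndrome w (window \<alpha> v (i div 3)) (i mod 3)"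
      by (simp add: hex_syndrome_def)
    moreover have "(H_mat l w \<alpha> (\<alpha> * w\<^sup>2) (\<alpha> * w) *\<^sub>v v) $ i = (?T *\<^sub>v x) $ i"
      using True T K by (simp add: H del: index_mult_mat_vec)
    ultimately show ?thesis using True x by (simp only: H_tilde_mult_vec)
  next
    case False
    then obtain j where j: "i = j + 6" by (metis add.commute le_Suc_ex not_less)
    \<comment> \<open>Block \<open>j div 3\<close> of \<open>y\<close> starts at coordinate 11 + 6 *
      (j div 3) of \<open>v\<close>, which is the start 6 * b - 1 of window b = j div 3 + 2.\<close>
    have win: "window \<alpha> v (i div 3) k = y $ (j div 3 * 6 + k)" if "k < 6" for k
    proof -
      have "j div 3 < m" using i lm j by auto
      then have "j div 3 * 6 + k < 6 * m" using that by auto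
      moreover have "(j + 6) div 3 = j div 3 + 2" by simp
      ultimately show ?thesis using x y unfolding vxy window_def j by (auto simp: mult.commute)
    qed
    have jm: "j < m * 3" using i lm j by simp
    have "(H_mat l w \<alpha> (\<alpha> * w\<^sup>2) (\<alpha> * w) *\<^sub>v v) $ i = (?K *\<^sub>v y) $ j"
      using T K x y jm by (simp add: H j)
    also have "\<dots> = (\<Sum>k<6. H_block w $$ (j mod 3, k) * y $ (j div 3 * 6 + k))"
      using B y jm by (intro kronecker_one_mult_vec) (auto simp: mult.commute)
    also have "\<dots> = hex_syndrome w (window \<alpha> v (i div 3)) (j mod 3)"
      by (simp add: hex_syndrome_def win)
    also have "j mod 3 = i mod 3" unfolding j by presburger
    finally show ?thesis .
  qed
qed

lemma mat_kernel_H_mat_iff: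
  fixes w :: "'a::field"
  assumes l: "l \<ge> 2"
  shows "v \<in> mat_kernel (H_mat l w \<alpha> (\<alpha> * w\<^sup>2) (\<alpha> * w)) \<longleftrightarrow>
    v \<in> carrier_vec (6 * l - 1) \<and> (\<forall>b<l. hexacode w (window \<alpha> v b))" (is "_ \<in> mat_kernel ?H \<longleftrightarrow> _")
proof -
  have H: "?H \<in> carrier_mat (3 * l) (6 * l - 1)" using l by (rule H_mat_carrier)
  have "?H *\<^sub>v v = 0\<^sub>v (3 * l) \<longleftrightarrow> (\<forall>b<l. hexacode w (window \<alpha> v b))"
    if v: "v \<in> carrier_vec (6 * l - 1)"
  proof -
    have "?H *\<^sub>v v = 0\<^sub>v (3 * l) \<longleftrightarrow>
        (\<forall>i<3 * l. hex_syndrome w (window \<alpha> v (i div 3)) (i mod 3) = 0)"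
      using H carrier_matD[OF H] by (auto simp: vec_eq_iff H_mat_mult_vec[OF l v, symmetric] simp del: index_mult_mat_vec)
    also have "\<dots> \<longleftrightarrow> (\<forall>b<l. hexacode w (window \<alpha> v b))"
    proof (intro iffI allI impI)
      fix b assume *: "\<forall>i<3 * l. hex_syndrome w (window \<alpha> v (i div 3)) (i mod 3) = 0" and "b < l"
      show "hexacode w (window \<alpha> v b)" unfolding hexacode_def
      proof (intro allI impI)
        fix c :: nat assume "c < 3"
        then show "hex_syndrome w (window \<alpha> v b) c = 0"
          using *[rule_format, of "3 * b + c"] \<open>b < l\<close> by simp
      qed
    next
      fix i assume "\<forall>b<l. hexacode w (window \<alpha> v b)" and "i < 3 * l"
      then show "hex_syndrome w (window \<alpha> v (i div 3)) (i mod 3) = 0"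
        by (simp add: hexacode_def less_mult_imp_div_less mult.commute)
    qed
    finally show ?thesis .
  qed
  then show ?thesis using mat_kernel[OF H] by auto
qed

lemma code_dim_H_mat:
  fixes w :: "'a::field"
  assumes l: "l \<ge> 2"
  shows "code_dim (6 * l - 1) (mat_kernel (H_mat l w \<alpha> (\<alpha> * w\<^sup>2) (\<alpha> * w))) = 3 * l - 1"
    (is "code_dim _ (mat_kernel ?H) = _")
proof -
  have H: "?H \<in> carrier_mat (3 * l) (6 * l - 1)" using l by (rule H_mat_carrier)
  have "code_dim (6 * l - 1) (mat_kernel ?H) = (6 * l - 1) - 3 * l"
  proof (rule code_dim_mat_kernel[OF H])
    fix y :: "'a vec" assume y: "y \<in> carrier_vec (3 * l)"
    \<comment> \<open>\<open>H_block w\<close> begins with an identity matrix, so copying three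
      entries of \<open>y\<close> to the start of each window nearly gives a preimage. Coordinate 5
      then holds \<open>y $ 3\<close> and leaks into window 0 as \<open>\<alpha> * y $ 3\<close>;
      the subtracted term compensates for this.\<close>
    define g where "g = (\<lambda>b k. if k < 3
      then y $ (3 * b + k) - (if b = 0 then H_block w $$ (k, 5) * \<alpha> * y $ 3 else 0) else 0)"
    \<comment> \<open>Coordinate \<open>j\<close> is filled from window
      \<open>(j + 1) div 6\<close>, so the shared coordinate 5 counts as the first entry of window
      1.\<close>
    define x where "x = vec (6 * l - 1) (\<lambda>j. g ((j + 1) div 6) (j - (6 * ((j + 1) div 6) - 1)))"
    have x: "x \<in> carrier_vec (6 * l - 1)" by (simp add: x_def)
    have g: "x $ (6 * b - 1 + k) = g b k" if "b < l" "k < 6" "\<not> (b = 0 \<and> k = 5)" for b k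
    proof -
      have "(6 * b - 1 + k + 1) div 6 = b" "6 * b - 1 + k < 6 * l - 1"
        using that by (cases b; auto)+
      then show ?thesis by (simp add: x_def)
    qed
    have win: "window \<alpha> x b k = (if b = 0 \<and> k = 5 then \<alpha> * y $ 3 else g b k)"
      if "b < l" "k < 6" for b k
      using that g[of b k] g[of 1 0] l by (auto simp: window_def g_def)
    have "(?H *\<^sub>v x) $ i = y $ i" if i: "i < 3 * l" for i
    proof -
      have b: "i div 3 < l" using i by auto
      have syn: "hex_syndrome w (window \<alpha> x (i div 3)) c = y $ (3 * (i div 3) + c)"
        if "c \<in> {0, Suc 0, 2}" for c
        using that b by (elim insertE emptyE; simp add: hex_syndrome_simps win)
          (auto simp: g_def H_block_def mat_of_rows_list_def)
      have "i mod 3 \<in> {0, Suc 0, 2}" by auto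
      then have "hex_syndrome w (window \<alpha> x (i div 3)) (i mod 3) = y $ (3 * (i div 3) + i mod 3)"
        by (rule syn)
      then show ?thesis by (simp add: H_mat_mult_vec[OF l x i])
    qed
    then have "?H *\<^sub>v x = y" using y H by (intro eq_vecI) auto
    then show "\<exists>x\<in>carrier_vec (6 * l - 1). ?H *\<^sub>v x = y" using x by blast
  qed
  then show ?thesis by simp
qed

section \<open>Repair sets and their local distance\<close>

text \<open>Coordinate 5 is left out of the first repair set when \<open>\<alpha> = 0\<close>, as it is then unconstrained there.\<close>

definition repair_set :: "'a::field \<Rightarrow> nat \<Rightarrow> nat set" where
  "repair_set \<alpha> b = (\<lambda>k. 6 * b - 1 + k) ` {k. k < 6 \<and> \<not> (b = 0 \<and> k = 5 \<and> \<alpha> = 0)}"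

lemma card_repair_set: "card (repair_set \<alpha> b) \<le> 6"
proof -
  have "card {k::nat. k < 6 \<and> \<not> (b = 0 \<and> k = 5 \<and> \<alpha> = 0)} \<le> card {..<6::nat}"
    by (intro card_mono) auto
  then show ?thesis unfolding repair_set_def by (intro card_image_le[THEN order_trans]) auto
qed

lemma repair_set_subset: "l \<ge> 2 \<Longrightarrow> b < l \<Longrightarrow> repair_set \<alpha> b \<subseteq> {..<6 * l - 1}"
proof
  fix i assume "l \<ge> 2" "b < l" "i \<in> repair_set \<alpha> b"
  moreover from this(3) obtain k where "k < 6" "i = 6 * b - 1 + k"
    unfolding repair_set_def by blast
  ultimately have "i < 6 * l - 1" by linarith
  then show "i \<in> {..<6 * l - 1}" by simp
qed

text \<open>Coordinate 5 is assigned to window 1, so its possible absence from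
  \<open>repair_set \<alpha> 0\<close> does no harm.\<close>

lemma in_repair_set: "i \<in> repair_set \<alpha> ((i + 1) div 6)"
  unfolding repair_set_def
proof (rule image_eqI)
  let ?b = "(i + 1) div 6"
  show "i = 6 * ?b - 1 + (i - (6 * ?b - 1))" by linarith
  show "i - (6 * ?b - 1) \<in> {k. k < 6 \<and> \<not> (?b = 0 \<and> k = 5 \<and> \<alpha> = 0)}"
    by auto
qed

text \<open>Only coordinate 5 in window 0 is delicate: for \<alpha> nonzero the scaling preserves
  being nonzero, and for \<alpha> = 0 the window entry is 0 and the repair set omits the
  coordinate.\<close>

lemma window_weight:
  "card {i \<in> repair_set \<alpha> b. v $ i \<noteq> 0} = card {k. k < 6 \<and> window \<alpha> v b k \<noteq> 0}"
proof -
  have "{i \<in> repair_set \<alpha> b. v $ i \<noteq> 0} = (\<lambda>k. 6 * b - 1 + k) ` {k. k < 6 \<and> window \<alpha> v b k \<noteq> 0}"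
    unfolding repair_set_def Compr_image_eq
    by (intro arg_cong[where f = "image _"]) (cases b; auto simp: window_def split: if_splits)
  then show ?thesis by (simp add: card_image inj_on_def)
qed

text \<open>A codeword punctured to a repair set has the weight of its window, which is a hexacode
  word.\<close>

lemma repair_set_min_distance:
  fixes w :: "'a::field"
  assumes "CARD('a) = 4" "w\<^sup>2 = w + 1" and l: "l \<ge> 2" and b: "b < l"
  shows "enat 4 \<le> min_distance
    (puncture (repair_set \<alpha> b) (mat_kernel (H_mat l w \<alpha> (\<alpha> * w\<^sup>2) (\<alpha> * w))))"
  unfolding enat_le_min_distance_iff puncture_def
proof (intro ballI impI, elim imageE, hypsubst)
  fix v assume v: "v \<in> mat_kernel (H_mat l w \<alpha> (\<alpha> * w\<^sup>2) (\<alpha> * w))"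
    and nz: "hamming_weight (puncture_vec (repair_set \<alpha> b) v) \<noteq> 0"
  have d: "dim_vec v = 6 * l - 1" using v l by (auto simp: mat_kernel_H_mat_iff)
  have "{i \<in> repair_set \<alpha> b. i < dim_vec v \<and> v $ i \<noteq> 0} = {i \<in> repair_set \<alpha> b. v $ i \<noteq> 0}"
    using repair_set_subset[OF l b, of \<alpha>] d by auto
  then have *: "hamming_weight (puncture_vec (repair_set \<alpha> b) v)
      = card {k. k < 6 \<and> window \<alpha> v b k \<noteq> 0}"
    by (simp add: hamming_weight_puncture_vec window_weight)
  with nz have "{k. k < 6 \<and> window \<alpha> v b k \<noteq> 0} \<noteq> {}" by (metis card.empty)
  then obtain k where k: "k < 6" "window \<alpha> v b k \<noteq> 0" by blast
  have "hexacode w (window \<alpha> v b)" using v b by (simp add: mat_kernel_H_mat_iff[OF l])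
  then show "4 \<le> hamming_weight (puncture_vec (repair_set \<alpha> b) v)"
    unfolding * using k by (rule hexacode_weight[OF assms(1,2)])
qed

section \<open>Explicit codewords\<close>

text \<open>Windows from number 2 on start at coordinate 11 or later, where the word is zero, so
  only windows 0 and 1 impose conditions.\<close>

lemma H_mat_kernel_wordI:
  fixes w :: "'a::field"
  assumes l: "l \<ge> 2" and g: "\<And>j. j \<ge> 11 \<Longrightarrow> g j = 0"
    and "hexacode w (\<lambda>k. if k = 5 then \<alpha> * g 5 else g k)" "hexacode w (\<lambda>k. g (5 + k))"
  shows "vec (6 * l - 1) g \<in> mat_kernel (H_mat l w \<alpha> (\<alpha> * w\<^sup>2) (\<alpha> * w))"
proof -
  let ?v = "vec (6 * l - 1) g"
  have hex: "hexacode w (window \<alpha> ?v b) \<longleftrightarrow> hexacode w (\<lambda>k. if b = 0 \<and> k = 5 then \<alpha> * g 5 else g (6 * b - 1 + k))"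
    if "b < l" for b
  proof -
    have "window \<alpha> ?v b k = (if b = 0 \<and> k = 5 then \<alpha> * g 5 else g (6 * b - 1 + k))" if "k < 6" for k
    proof -
      have "6 * b - 1 + k < 6 * l - 1 \<or> b = 0 \<and> k = 5" using \<open>b < l\<close> \<open>k < 6\<close> by (cases b) auto
      then show ?thesis using l by (auto simp: window_def)
    qed
    then show ?thesis by (simp add: hexacode_iff)
  qed
  have "hexacode w (window \<alpha> ?v b)" if "b < l" for b
  proof -
    consider "b = 0" | "b = 1" | "b \<ge> 2" by linarith
    then show ?thesis
    proof cases
      case 3
      then have "g (6 * b - 1 + k) = 0" for k by (intro g) auto
      with 3 show ?thesis unfolding hex[OF that] by (auto simp: hexacode_iff)
    qed (unfold hex[OF that], use assms in \<open>simp_all add: hexacode_iff numeral_2_eq_2[symmetric]\<close>)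
  qed
  then show ?thesis by (simp add: mat_kernel_H_mat_iff[OF l])
qed

lemma H_mat_kernel_words:
  fixes w \<alpha> :: "'a::field"
  assumes card: "CARD('a) = 4" and w: "w\<^sup>2 = w + 1" and l: "l \<ge> 2"
  defines "C \<equiv> mat_kernel (H_mat l w \<alpha> (\<alpha> * w\<^sup>2) (\<alpha> * w))"
  obtains u1 u2 u3 where
    "u1 \<in> C" "{i. i < 6 * l - 1 \<and> u1 $ i \<noteq> 0} = {6, 7, 9, 10}"
    "u2 \<in> C" "{i. i < 6 * l - 1 \<and> u2 $ i \<noteq> 0} = {6, 7, 8, 10}"
    "u3 \<in> C" "{i. 5 \<le> i \<and> i < 6 * l - 1 \<and> u3 $ i \<noteq> 0} = {5, 6, 7, 8}"
proof -
  note dbl = char2_field_simps[OF char2_of_card4[OF card]]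
  have w0: "w \<noteq> 0" using w by auto
  \<comment> \<open>On window 1, that is coordinates 5 to 10, each word is the hexacode word with
    prescribed last three entries: (0, 1, 1) for \<open>g1\<close>, (1, 0, 1) for \<open>g2\<close>
    and (1, 0, 0) for \<open>g3\<close>. The first two vanish at coordinate 5 and leave window 0
    empty.\<close>
  define g1 :: "nat \<Rightarrow> 'a" where "g1 = (\<lambda>j. if j \<in> {6, 7, 9, 10} then 1 else 0)"
  define g2 :: "nat \<Rightarrow> 'a" where "g2 = (\<lambda>j. if j = 6 then w else if j = 7 then w\<^sup>2 else if j \<in> {8, 10} then 1 else 0)"
  \<comment> \<open>Here coordinate 5 is 1 and contributes \<alpha> to window 0; the entries at 0,
    1, 2 cancel it in characteristic 2.\<close>
  define g3 :: "nat \<Rightarrow> 'a" where "g3 = (\<lambda>j. if j = 0 then \<alpha> else if j = 1 then \<alpha> * w\<^sup>2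
    else if j = 2 then \<alpha> * w else if j \<in> {5, 6, 7, 8} then 1 else 0)"
  show ?thesis
  proof (rule that)
    show "vec (6 * l - 1) g1 \<in> C" unfolding C_def
      by (rule H_mat_kernel_wordI[OF l]) (auto simp: g1_def hexacode_iff w dbl ac_simps)
    show "vec (6 * l - 1) g2 \<in> C" unfolding C_def
      by (rule H_mat_kernel_wordI[OF l]) (auto simp: g2_def hexacode_iff w dbl ac_simps)
    show "vec (6 * l - 1) g3 \<in> C" unfolding C_def
      by (rule H_mat_kernel_wordI[OF l]) (auto simp: g3_def hexacode_iff dbl ac_simps)
    show "{i. i < 6 * l - 1 \<and> vec (6 * l - 1) g1 $ i \<noteq> 0} = {6, 7, 9, 10}"
      using l by (auto simp: g1_def split: if_splits)
    show "{i. i < 6 * l - 1 \<and> vec (6 * l - 1) g2 $ i \<noteq> 0} = {6, 7, 8, 10}"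
      using l w0 by (auto simp: g2_def split: if_splits)
    show "{i. 5 \<le> i \<and> i < 6 * l - 1 \<and> vec (6 * l - 1) g3 $ i \<noteq> 0} = {5, 6, 7, 8}"
      using l by (auto simp: g3_def split: if_splits)
  qed
qed

section \<open>Locality, distance and optimality\<close>

lemma lrc_H_mat:
  fixes w :: "'a::field"
  assumes card: "CARD('a) = 4" and w: "w\<^sup>2 = w + 1" and l: "l \<ge> 2"
  shows "lrc (6 * l - 1) (3 * l - 1) 4 3 4 (mat_kernel (H_mat l w \<alpha> (\<alpha> * w\<^sup>2) (\<alpha> * w)))"
    (is "lrc ?n _ _ _ _ ?C")
proof -
  have local: "\<exists>R\<subseteq>{..<?n}. i \<in> R \<and> card R \<le> 3 + 4 - 1 \<and> enat 4 \<le> min_distance (puncture R ?C)"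
    if "i < ?n" for i
  proof -
    have "(i + 1) div 6 < l" using that by auto
    then show ?thesis
      using repair_set_subset[OF l] in_repair_set repair_set_min_distance[OF card w l]
        card_repair_set[of \<alpha> "(i + 1) div 6"]
      by (intro exI[of _ "repair_set \<alpha> ((i + 1) div 6)"] conjI) simp_all
  qed
  have dim: "dim_vec v = ?n" if "v \<in> ?C" for v using that l by (auto simp: mat_kernel_H_mat_iff)
  have "enat 4 \<le> min_distance ?C"
    unfolding enat_le_min_distance_iff
  proof (intro ballI impI)
    fix v assume v: "v \<in> ?C" and "hamming_weight v \<noteq> 0"
    then obtain i where i: "i < ?n" "v $ i \<noteq> 0" using dim[OF v] by (auto simp: hamming_weight_eq_0_iff vec_eq_iff)
    obtain R where R: "i \<in> R" "enat 4 \<le> min_distance (puncture R ?C)" using local[OF i(1)] by blast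
    let ?S = "{i \<in> R. i < dim_vec v \<and> v $ i \<noteq> 0}"
    have "card ?S \<noteq> 0" using R(1) i dim[OF v] by auto
    then have "4 \<le> card ?S"
      using R(2) v unfolding enat_le_min_distance_iff puncture_def hamming_weight_puncture_vec[symmetric]
      by blast
    also have "\<dots> \<le> hamming_weight v" unfolding hamming_weight_def by (intro card_mono) auto
    finally show "4 \<le> hamming_weight v" .
  qed
  \<comment> \<open>A word of weight 4 shows that the lower bound on the distance is
    attained.\<close>
  moreover obtain u where u: "u \<in> ?C" "{i. i < ?n \<and> u $ i \<noteq> 0} = {6, 7, 9, 10}"
    by (rule H_mat_kernel_words[OF card w l, of \<alpha>]) blast
  have hw: "hamming_weight u = 4" using u(2) dim[OF u(1)] by (simp add: hamming_weight_def)
  then have "min_distance ?C \<le> enat 4"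
    using u(1) hamming_weight_eq_0_iff[of u] hw[symmetric] unfolding min_distance_def
    by (intro INF_lower2[of u]) auto
  ultimately have "min_distance ?C = enat 4" by simp
  then show ?thesis
    using local linear_code_mat_kernel[OF H_mat_carrier[OF l, of w \<alpha> "\<alpha> * w\<^sup>2" "\<alpha> * w"]]
      code_dim_H_mat[OF l, of w \<alpha>]
    by (simp add: lrc_def code_params_def)
qed

lemma not_lrc_H_mat:
  fixes w :: "'a::field"
  assumes card: "CARD('a) = 4" and w: "w\<^sup>2 = w + 1" and l: "l \<ge> 2" and r: "r \<le> 2"
  shows "\<not> lrc (6 * l - 1) k d r 4 (mat_kernel (H_mat l w \<alpha> (\<alpha> * w\<^sup>2) (\<alpha> * w)))"
    (is "\<not> lrc ?n _ _ _ _ ?C")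
proof
  assume lrc: "lrc ?n k d r 4 ?C"
  have "10 < ?n" using l by simp
  with lrc obtain R where R: "R \<subseteq> {..<?n}" "10 \<in> R" "card R \<le> r + 4 - 1"
    "enat 4 \<le> min_distance (puncture R ?C)"
    unfolding lrc_def by blast
  have card_R: "card R \<le> 5" using R(3) r by simp
  have fin: "finite R" using R(1) finite_subset by blast
  have weight: "{i \<in> R. i < ?n \<and> v $ i \<noteq> 0} = {} \<or> 4 \<le> card {i \<in> R. i < ?n \<and> v $ i \<noteq> 0}"
    if "v \<in> ?C" for v
  proof -
    have "dim_vec v = ?n" using that l by (auto simp: mat_kernel_H_mat_iff)
    then show ?thesis using R(4) that fin
      by (auto simp: enat_le_min_distance_iff puncture_def hamming_weight_puncture_vec)
  qed
  \<comment> \<open>No codeword may have between one and three nonzero entries on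
    \<open>R\<close>.\<close>
  have no_word: False
    if v: "v \<in> ?C" and supp: "{i \<in> R. i < ?n \<and> v $ i \<noteq> 0} \<subseteq> S" "finite S" "card S \<le> 3"
      and i: "i \<in> R" "i < ?n" "v $ i \<noteq> 0" for v S i
    using weight[OF v] card_mono[OF supp(2,1)] supp(3) i by auto
  obtain u1 u2 u3 where u:
    "u1 \<in> ?C" "{i. i < ?n \<and> u1 $ i \<noteq> 0} = {6, 7, 9, 10}"
    "u2 \<in> ?C" "{i. i < ?n \<and> u2 $ i \<noteq> 0} = {6, 7, 8, 10}"
    "u3 \<in> ?C" "{i. 5 \<le> i \<and> i < ?n \<and> u3 $ i \<noteq> 0} = {5, 6, 7, 8}"
    by (rule H_mat_kernel_words[OF card w l])
  \<comment> \<open>Coordinate 10 lies in \<open>R\<close> and in the supports of \<open>u1\<close>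
    and \<open>u2\<close>, so a further support element missing from \<open>R\<close> leaves at most
    three and at least one.\<close>
  consider j where "j \<in> {6, 7, 9}" "j \<notin> R" | "8 \<notin> R" | "{6, 7, 8, 9, 10} \<subseteq> R"
    using R(2) by auto
  then show False
  proof cases
    case 1
    show False
    proof (rule no_word[OF u(1)])
      show "{i \<in> R. i < ?n \<and> u1 $ i \<noteq> 0} \<subseteq> {6, 7, 9, 10} - {j}" using u(2) 1 by blast
      show "card ({6, 7, 9, 10} - {j}) \<le> 3" using 1 by auto
      show "10 < ?n" "u1 $ 10 \<noteq> 0" using u(2) by blast+
    qed (use R in auto)
  next
    case 2
    show False
    proof (rule no_word[OF u(3)])
      show "{i \<in> R. i < ?n \<and> u2 $ i \<noteq> 0} \<subseteq> {6, 7, 10}" using u(4) 2 by blast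
      show "10 < ?n" "u2 $ 10 \<noteq> 0" using u(4) by blast+
    qed (use R in auto)
  next
    case 3
    then have R_eq: "R = {6, 7, 8, 9, 10}" using card_R fin by (intro card_seteq[symmetric]) auto
    show False
    proof (rule no_word[OF u(5)])
      \<comment> \<open>\<open>R\<close> avoids the coordinates 0 to 4, where the support of
        \<open>u3\<close> depends on \<alpha>, and also coordinate 5.\<close>
      have "{i \<in> R. i < ?n \<and> u3 $ i \<noteq> 0} \<subseteq> {i. 5 \<le> i \<and> i < ?n \<and> u3 $ i \<noteq> 0} \<inter> R"
        unfolding R_eq by auto
      also have "\<dots> \<subseteq> {6, 7, 8}" unfolding u(6) R_eq by auto
      finally show "{i \<in> R. i < ?n \<and> u3 $ i \<noteq> 0} \<subseteq> {6, 7, 8}" .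
      show "8 < ?n" "u3 $ 8 \<noteq> 0" using u(6) by blast+
    qed (use R_eq in auto)
  qed
qed

theorem mainTheorem8:
  fixes w \<alpha> \<beta> \<gamma> :: "'a::field" and l :: nat
  assumes "CARD('a) = 4"
    and "w^2 = w + 1"
    and "l \<ge> 2"
    and "(\<alpha>, \<beta>, \<gamma>) = (0, 0, 0) \<or> (\<alpha>, \<beta>, \<gamma>) = (1, w^2, w)"
  shows "optimal_lrc (6 * l - 1) (3 * l - 1) 4 3 4 (mat_kernel (H_mat l w \<alpha> \<beta> \<gamma>))"
proof -
  have eq: "\<beta> = \<alpha> * w\<^sup>2" "\<gamma> = \<alpha> * w" using assms(4) by auto
  \<comment> \<open>With this ceiling the Singleton-type bound evaluates to (6l - 1) - (3l - 1) + 1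
    - 3(l - 1) = 4.\<close>
  have "\<lceil>real (3 * l - 1) / real 3\<rceil> = int l"
    using assms(3) by (intro ceiling_unique) auto
  then show ?thesis
    using lrc_H_mat[OF assms(1-3), of \<alpha>] not_lrc_H_mat[OF assms(1-3), of _ _ _ \<alpha>] assms(3)
    unfolding optimal_lrc_def d_optimal_lrc_def r_optimal_lrc_def eq by auto
qed

end
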